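(* Let $f,g:\mathbb{R}^{\mathbb{Z}_{<}}\to\mathbb{R}^{\mathbb{Z}_{<}}$ be functions and let $k,n,l,o,q\in\mathbb{N}$. (i) If $f$ is $(k,n)$-continuous, then it is $(k,n+1)$-continuous. (ii) If $f$ is $(k+1,n)$-continuous, then it is $(k,n)$-continuous. (iii) If $f$ is $(k,n)$-continuous for all $k,n\in\mathbb{N}$, then $f$ is constant on every infinitesimal neighbourhood, i.e. for every $\mathbf{c}$ and every $\mathbf{x}$ with $\operatorname{val}(\mathbf{x}-\mathbf{c})>0$, $f(\mathbf{x})=f(\mathbf{c})$. (iv) (Composition) If $f$ is $(k,n)$-continuous and $g$ is $(n,q)$-continuous, then $f\circ g$ is $(k,q)$-continuous. (v) (Product) If $f$ is $(k,n)$-continuous, $g$ is $(l,o)$-continuous, and both are bounded (all their values are finite), then $fg$ is $(\min(k,l),\max(n,o))$-continuous.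
   Context: $\mathbb{N}=\{0,1,2,\dots\}$. $\mathbb{R}^{\mathbb{Z}_{<}}$ is the field of all two-sided real sequences $\mathbf{x}=(x_n)_{n\in\mathbb{Z}}$ for which there exists $N$ with $x_n=0$ for all $n<-N$, with componentwise addition and Cauchy convolution $(\mathbf{x}\cdot\mathbf{y})_n=\sum_{k\in\mathbb{Z}}x_k y_{n-k}$. The valuation is $\operatorname{val}(\mathbf{x})=\min\{n:x_n\ne 0\}$, $\operatorname{val}(0)=\infty$. An element $\mathbf{x}$ is finite iff $\operatorname{val}(\mathbf{x})\ge 0$ (equivalently, $|\mathbf{x}|<r$ for some real $r$ in the lexicographic order of the field). For $k,n\in\mathbb{N}$, a function $f$ is $(k,n)$-continuous at $\mathbf{c}$ if for all $\mathbf{x}$, $\operatorname{val}(\mathbf{x}-\mathbf{c})\ge n$ implies $\operatorname{val}(f(\mathbf{x})-f(\mathbf{c}))\ge k$. A function is $(k,n)$-continuous if it is $(k,n)$-continuous at every $\mathbf{c}\in\mathbb{R}^{\mathbb{Z}_{<}}$. *)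

theory Defs
  imports "HOL-Computational_Algebra.Formal_Laurent_Series" "HOL-Library.Extended_Real"
begin

(* The field of real sequences (x_n), n in Z, that vanish for all sufficiently negative n, with
   componentwise addition and Cauchy convolution, is the library's field of formal Laurent series
   "real fls"; x_n is fls_nth x n. *)

type_synonym lfield = "real fls"

(* fls_subdegree x is the least index of a nonzero coefficient if x is nonzero, but
   fls_subdegree 0 = 0 in the library, hence the case distinction. *)

definition val :: "lfield \<Rightarrow> ereal" where
  "val x = (if x = 0 then \<infinity> else ereal (real_of_int (fls_subdegree x)))"

definition finite_elt :: "lfield \<Rightarrow> bool" where
  "finite_elt x \<longleftrightarrow> val x \<ge> 0"

definition kn_continuous_at :: "nat \<Rightarrow> nat \<Rightarrow> (lfield \<Rightarrow> lfield) \<Rightarrow> lfield \<Rightarrow> bool" where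
  "kn_continuous_at k n f c \<longleftrightarrow>
     (\<forall>x. val (x - c) \<ge> ereal (real n) \<longrightarrow> val (f x - f c) \<ge> ereal (real k))"

definition kn_continuous :: "nat \<Rightarrow> nat \<Rightarrow> (lfield \<Rightarrow> lfield) \<Rightarrow> bool" where
  "kn_continuous k n f \<longleftrightarrow> (\<forall>c. kn_continuous_at k n f c)"

definition bounded_fun :: "(lfield \<Rightarrow> lfield) \<Rightarrow> bool" where
  "bounded_fun f \<longleftrightarrow> (\<forall>x. finite_elt (f x))"

end

theory Submission imports Defs begin

text \<open>\<open>val\<close> is a non-archimedean valuation: it turns products into sums, and the
  elements of valuation at least a given bound are closed under addition. Weakening the indices and
  composing only chain implications. For the third claim, fix one threshold and let k grow: the
  difference of the two values then has valuation above every natural number, so it is 0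
  (\<open>eq_if_val_diff_unbounded\<close>). For products, the Leibniz splitting of a difference of
  products leaves each increment multiplied by a finite value, which cannot lower its valuation
  (\<open>kn_continuous_mult\<close>).\<close>

lemma val_mult: "val (x * y) = val x + val y"
  by (simp add: val_def)

lemma val_add_ge:
  assumes "a \<le> val x" and "a \<le> val y"
  shows "a \<le> val (x + y)"
\<comment> \<open>At 0 the subdegree defaults to 0 while \<open>val\<close> is infinite, so
  subdegrees can stand in for valuations only when both summands and the sum are nonzero.\<close>
proof (cases "x = 0 \<or> y = 0 \<or> x + y = 0")
  case True
  then show ?thesis using assms by (auto simp: val_def)
next
  case False
  then have "min (fls_subdegree x) (fls_subdegree y) \<le> fls_subdegree (x + y)"
    by (intro fls_plus_subdegree) auto
  then have "min (val x) (val y) \<le> val (x + y)"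
    using False by (auto simp: val_def min_def split: if_splits)
  then show ?thesis using assms by (meson min.boundedI order_trans)
qed

text \<open>A nonzero element has an integer valuation, and by the Archimedean property some natural
  number exceeds it.\<close>

lemma eq_if_val_diff_unbounded:
  assumes "\<And>k. val (x - y) \<ge> ereal (real k)"
  shows "x = y"
proof (rule ccontr)
  assume "x \<noteq> y"
  then have "real k \<le> real_of_int (fls_subdegree (x - y))" for k
    using assms[of k] by (simp add: val_def)
  then show False
    by (metis linorder_not_le reals_Archimedean2)
qed

lemma kn_continuousD:
  assumes "kn_continuous k n f" and "val (x - c) \<ge> ereal (real n)"
  shows "val (f x - f c) \<ge> ereal (real k)"
  using assms by (simp add: kn_continuous_def kn_continuous_at_def)

lemma kn_continuousI:
  assumes "\<And>x c. val (x - c) \<ge> ereal (real n) \<Longrightarrow> val (f x - f c) \<ge> ereal (real k)"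
  shows "kn_continuous k n f"
  using assms by (simp add: kn_continuous_def kn_continuous_at_def)

text \<open>Raising n shrinks the neighbourhood to be tested, and lowering k relaxes the demand on
  the values. Besides the first two claims, this brings the factors of a product to common
  indices.\<close>

lemma kn_continuous_mono:
  assumes "kn_continuous k n f" and "k' \<le> k" and "n \<le> n'"
  shows "kn_continuous k' n' f"
proof (rule kn_continuousI)
  fix x c
  assume "val (x - c) \<ge> ereal (real n')"
  moreover have "ereal (real n') \<ge> ereal (real n)" using assms(3) by simp
  ultimately have "val (f x - f c) \<ge> ereal (real k)"
    using kn_continuousD[OF assms(1)] order_trans by blast
  moreover have "ereal (real k) \<ge> ereal (real k')" using assms(2) by simp
  ultimately show "val (f x - f c) \<ge> ereal (real k')" by (rule order_trans[rotated])
qed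

lemma kn_continuous_comp:
  assumes "kn_continuous k n f" and "kn_continuous n q g"
  shows "kn_continuous k q (f \<circ> g)"
  using assms by (auto intro!: kn_continuousI dest: kn_continuousD)

lemma kn_continuous_mult:
  assumes f: "kn_continuous k n f" "bounded_fun f"
    and g: "kn_continuous k n g" "bounded_fun g"
  shows "kn_continuous k n (\<lambda>x. f x * g x)"
proof (rule kn_continuousI)
  fix x c
  assume *: "val (x - c) \<ge> ereal (real n)"
  \<comment> \<open>These are the two cofactors in the splitting used below: \<open>f x\<close>
    multiplies the increment of \<open>g\<close>, and \<open>g c\<close> that of
    \<open>f\<close>.\<close>
  have fin: "val (f x) \<ge> 0" "val (g c) \<ge> 0"
    using f(2) g(2) by (auto simp: bounded_fun_def finite_elt_def)
  have "ereal (real k) \<le> val (f x * (g x - g c))"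
    using add_mono[OF fin(1) kn_continuousD[OF g(1) *]] by (simp add: val_mult)
  moreover have "ereal (real k) \<le> val ((f x - f c) * g c)"
    using add_mono[OF kn_continuousD[OF f(1) *] fin(2)] by (simp add: val_mult)
  moreover have "f x * g x - f c * g c = f x * (g x - g c) + (f x - f c) * g c"
    by (simp add: algebra_simps)
  ultimately show "val (f x * g x - f c * g c) \<ge> ereal (real k)"
    using val_add_ge by metis
qed

theorem theorem7p1:
  fixes f g :: "lfield \<Rightarrow> lfield" and k n l m q :: nat
  shows "(kn_continuous k n f \<longrightarrow> kn_continuous k (n + 1) f)
    \<and> (kn_continuous (k + 1) n f \<longrightarrow> kn_continuous k n f)
    \<and> ((\<forall>k' n'. kn_continuous k' n' f) \<longrightarrow> (\<forall>c x. val (x - c) > 0 \<longrightarrow> f x = f c))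
    \<and> (kn_continuous k n f \<and> kn_continuous n q g \<longrightarrow> kn_continuous k q (f \<circ> g))
    \<and> (kn_continuous k n f \<and> kn_continuous l m g \<and> bounded_fun f \<and> bounded_fun g
        \<longrightarrow> kn_continuous (min k l) (max n m) (\<lambda>x. f x * g x))"
proof (intro conjI impI allI; (elim conjE)?)
  assume "kn_continuous k n f"
  then show "kn_continuous k (n + 1) f" by (rule kn_continuous_mono) auto
next
  assume "kn_continuous (k + 1) n f"
  then show "kn_continuous k n f" by (rule kn_continuous_mono) auto
next
  fix c x
  assume cont: "\<forall>k' n'. kn_continuous k' n' f" and "val (x - c) > 0"
  \<comment> \<open>Positive valuation meets the threshold n = 0, which is then kept fixed while k
    ranges over all naturals.\<close>
  then have "val (x - c) \<ge> ereal (real 0)" by (simp add: zero_ereal_def[symmetric])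
  then show "f x = f c"
    using cont kn_continuousD by (intro eq_if_val_diff_unbounded) blast
next
  assume "kn_continuous k n f" "kn_continuous n q g"
  then show "kn_continuous k q (f \<circ> g)" by (rule kn_continuous_comp)
next
  assume "kn_continuous k n f" "kn_continuous l m g" "bounded_fun f" "bounded_fun g"
  then show "kn_continuous (min k l) (max n m) (\<lambda>x. f x * g x)"
    \<comment> \<open>Both factors are first weakened to the shared indices \<open>min k l\<close>
      and \<open>max n m\<close>.\<close>
    by (intro kn_continuous_mult) (auto elim: kn_continuous_mono)
qed

end
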